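(* Let $X$ be the squarefree flow, let $G=\prod_p\mathbb{Z}/p^2\mathbb{Z}$ with mass-one Haar measure $m$, let $\omega_{(1/2,1/2)}$ be the $(1/2,1/2)$ Bernoulli measure on $\Omega^{(2)}$, let $\iota:G\times\Omega^{(2)}\to X$ be the insertion map, and let $\eta=\iota_{*}(m\times\omega_{(1/2,1/2)})$ (the unique measure of maximal entropy on $X$). Then $\eta$ is not a Gibbs measure.
   Context: $\mathbb{N}=\{1,2,3,\dots\}$; $\Omega^{(2)}=\{0,1\}^{\mathbb{N}}$ with the product topology, and $\sigma$ is the left shift $(\sigma x)_n=x_{n+1}$. For $x\in\Omega^{(2)}$, $\operatorname{supp}(x)=\{n\in\mathbb{N}:x_n=1\}$. The squarefree flow $X\subset\Omega^{(2)}$ is the closed shift-invariant set of all $x$ such that for every prime $p$ the reduction of $\operatorname{supp}(x)$ modulo $p^2$ is a proper subset of $\mathbb{Z}/p^2\mathbb{Z}$. The product defining $G$ is over all primes $p$. The measure $\omega_{(1/2,1/2)}$ is the product measure on $\{0,1\}^{\mathbb{N}}$ giving each symbol mass $1/2$ in each coordinate. For $g\in G$ and $k\in\mathbb{N}$ put $\alpha_g(k)=|\{1\le n\le k: n\equiv g_p\bmod p^2\text{ for some prime }p\}|$. The insertion map is the Borel map $\iota(g,y)_k=0$ if $k\equiv g_p\bmod p^2$ for some prime $p$, and $\iota(g,y)_k=y_{k-\alpha_g(k)}$ otherwise. Gibbs measure: an invariant probability measure $\mu$ supported on a closed subshift $X\subset\Omega^{(2)}$ is a Gibbs measure if there exists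 a constant $c>0$ such that for every $n\ge1$ and every word $w$ of length $n$ appearing in $X$ (i.e. $w=x_1\cdots x_n$ for some $x\in X$), one has $\mu(C_w)\ge c\cdot e^{-n\cdot h_{\text{top}}(X)}$, where $C_w=\{x\in X: x_1\cdots x_n=w\}$ and $h_{\text{top}}(X)$ is the topological entropy of $(X,\sigma)$. *)

theory Defs
  imports
    "HOL-Probability.Probability"
    "HOL-Algebra.Product_Groups"
    "HOL-Computational_Algebra.Primes"
    "HOL-Number_Theory.Cong"
begin

definition borel_of :: "'a topology \<Rightarrow> 'a measure" where
  "borel_of T = sigma (topspace T) {U. openin T U}"

subsection \<open>The full one-sided two-shift\<close>

text \<open>
  One-sided sequences are indexed by the positive integers, as extensional functions on the
  index set \<open>{1..}\<close>; in particular the value at 0 carries no information.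
\<close>

definition Omega2_top :: "(nat \<Rightarrow> nat) topology" where
  "Omega2_top = product_topology (\<lambda>_. discrete_topology {0, 1}) {1..}"

abbreviation Omega2 :: "(nat \<Rightarrow> nat) set" where
  "Omega2 \<equiv> topspace Omega2_top"

definition shift :: "(nat \<Rightarrow> nat) \<Rightarrow> (nat \<Rightarrow> nat)" where
  "shift x = (\<lambda>n\<in>{1..}. x (n + 1))"

definition bernoulli_half :: "(nat \<Rightarrow> nat) measure" where
  "bernoulli_half = PiM {1..} (\<lambda>_. uniform_count_measure {0, 1})"

definition subshift :: "(nat \<Rightarrow> nat) set \<Rightarrow> bool" where
  "subshift X \<longleftrightarrow> closedin Omega2_top X \<and> shift ` X \<subseteq> X"

definition prefix_word :: "nat \<Rightarrow> (nat \<Rightarrow> nat) \<Rightarrow> nat list" where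
  "prefix_word n x = map x [1..<n + 1]"

definition words :: "(nat \<Rightarrow> nat) set \<Rightarrow> nat \<Rightarrow> nat list set" where
  "words X n = prefix_word n ` X"

definition cylinder :: "(nat \<Rightarrow> nat) set \<Rightarrow> nat list \<Rightarrow> (nat \<Rightarrow> nat) set" where
  "cylinder X w = {x \<in> X. prefix_word (length w) x = w}"

subsection \<open>Topological entropy\<close>

text \<open>
  Entropy of a continuous self-map of a compact space in the sense of Adler, Konheim and
  McAndrew, by open covers, with the natural logarithm.
\<close>

definition open_cover :: "'a topology \<Rightarrow> 'a set set \<Rightarrow> bool" where
  "open_cover T \<U> \<longleftrightarrow> (\<forall>U\<in>\<U>. openin T U) \<and> \<Union>\<U> = topspace T"

text \<open>
  The least cardinality of a finite subcover; it is only meaningful if one exists, as is the case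
  for open covers of a compact space.
\<close>

definition min_subcover :: "'a topology \<Rightarrow> 'a set set \<Rightarrow> nat" where
  "min_subcover T \<U> = (LEAST k. \<exists>\<V>\<subseteq>\<U>. finite \<V> \<and> card \<V> = k \<and> \<Union>\<V> = topspace T)"

text \<open>The common refinement of the covers \<open>f\<^sup>-\<^sup>i \<U>\<close> for \<open>i < n\<close>.\<close>

definition iterated_cover :: "'a topology \<Rightarrow> ('a \<Rightarrow> 'a) \<Rightarrow> 'a set set \<Rightarrow> nat \<Rightarrow> 'a set set" where
  "iterated_cover T f \<U> n =
     {{x \<in> topspace T. \<forall>i<n. (f ^^ i) x \<in> u i} | u. \<forall>i<n. u i \<in> \<U>}"

text \<open>
  The limit superior is a limit whenever \<open>T\<close> is compact and nonempty and \<open>f\<close> is continuous, by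
  subadditivity. The term for \<open>n = 0\<close> is irrelevant.
\<close>

definition cover_entropy :: "'a topology \<Rightarrow> ('a \<Rightarrow> 'a) \<Rightarrow> 'a set set \<Rightarrow> ereal" where
  "cover_entropy T f \<U> =
     limsup (\<lambda>n. ereal (ln (real (min_subcover T (iterated_cover T f \<U> n))) / real n))"

definition topological_entropy :: "'a topology \<Rightarrow> ('a \<Rightarrow> 'a) \<Rightarrow> ereal" where
  "topological_entropy T f = (SUP \<U>\<in>{\<U>. open_cover T \<U>}. cover_entropy T f \<U>)"

subsection \<open>Gibbs measures\<close>

text \<open>
  A subshift of the two-shift has entropy at most \<open>ln 2\<close>, so nothing is lost by passing to
  the reals.
\<close>

definition h_top :: "(nat \<Rightarrow> nat) set \<Rightarrow> real" where
  "h_top X = real_of_ereal (topological_entropy (subtopology Omega2_top X) shift)"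

definition invariant_prob_measure :: "(nat \<Rightarrow> nat) set \<Rightarrow> (nat \<Rightarrow> nat) measure \<Rightarrow> bool" where
  "invariant_prob_measure X \<mu> \<longleftrightarrow>
     sets \<mu> = sets (borel_of (subtopology Omega2_top X)) \<and> prob_space \<mu> \<and>
     shift \<in> measurable \<mu> \<mu> \<and> distr \<mu> \<mu> shift = \<mu>"

definition gibbs_measure :: "(nat \<Rightarrow> nat) set \<Rightarrow> (nat \<Rightarrow> nat) measure \<Rightarrow> bool" where
  "gibbs_measure X \<mu> \<longleftrightarrow>
     subshift X \<and> invariant_prob_measure X \<mu> \<and>
     (\<exists>c>0. \<forall>n\<ge>1. \<forall>w\<in>words X n. measure \<mu> (cylinder X w) \<ge> c * exp (- real n * h_top X))"

subsection \<open>The squarefree flow\<close>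

definition support :: "(nat \<Rightarrow> nat) \<Rightarrow> nat set" where
  "support x = {n \<in> {1..}. x n = 1}"

definition squarefree_flow :: "(nat \<Rightarrow> nat) set" where
  "squarefree_flow =
     {x \<in> Omega2. \<forall>p. prime p \<longrightarrow>
        (\<lambda>n. int n mod int (p\<^sup>2)) ` support x \<subset> carrier (integer_mod_group (p\<^sup>2))}"

definition G :: "(nat \<Rightarrow> int) monoid" where
  "G = product_group {p. prime p} (\<lambda>p. integer_mod_group (p\<^sup>2))"

definition G_top :: "(nat \<Rightarrow> int) topology" where
  "G_top = product_topology (\<lambda>p. discrete_topology (carrier (integer_mod_group (p\<^sup>2)))) {p. prime p}"

text \<open>
  Mass-one Haar measure of a compact group \<open>H\<close> with topology \<open>T\<close>. Regularity is not
  demanded: it is automatic for finite Borel measures on a compact metrizable space such as \<open>G\<close>.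
\<close>

definition normalized_haar_measure ::
    "('a, 'b) monoid_scheme \<Rightarrow> 'a topology \<Rightarrow> 'a measure \<Rightarrow> bool" where
  "normalized_haar_measure H T m \<longleftrightarrow>
     sets m = sets (borel_of T) \<and> prob_space m \<and>
     (\<forall>g\<in>carrier H. \<forall>A\<in>sets m. emeasure m (g <#\<^bsub>H\<^esub> A) = emeasure m A)"

subsection \<open>The insertion map\<close>

definition sieved :: "(nat \<Rightarrow> int) \<Rightarrow> nat \<Rightarrow> bool" where
  "sieved g n \<longleftrightarrow> (\<exists>p. prime p \<and> [int n = g p] (mod int (p\<^sup>2)))"

definition alpha :: "(nat \<Rightarrow> int) \<Rightarrow> nat \<Rightarrow> nat" where
  "alpha g k = card {n. 1 \<le> n \<and> n \<le> k \<and> sieved g n}"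

definition insertion :: "(nat \<Rightarrow> int) \<times> (nat \<Rightarrow> nat) \<Rightarrow> (nat \<Rightarrow> nat)" where
  "insertion = (\<lambda>(g, y). \<lambda>k\<in>{1..}. if sieved g k then 0 else y (k - alpha g k))"

definition eta :: "(nat \<Rightarrow> int) measure \<Rightarrow> (nat \<Rightarrow> nat) measure" where
  "eta m = distr (m \<Otimes>\<^sub>M bernoulli_half)
             (borel_of (subtopology Omega2_top squarefree_flow)) insertion"

end

theory Submission
  imports Defs "HOL-Real_Asymp.Real_Asymp"
begin

text \<open>
  The Gibbs lower bound fails for the words that carry as many ones as possible. Let \<open>M n\<close>, formally
  \<open>max_ones squarefree_flow n\<close>, be the largest number of ones among the first \<open>n\<close> symbols of a point of
  the flow. Such a word can be taken to be the indicator of the positions not sieved by some residue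
  system \<open>g\<close> that is zero modulo \<open>q\<^sup>2 > n\<close> (\<open>max_ones_attained_by_sieve\<close>).

  Suppose that the insertion of \<open>y\<close> along \<open>h\<close> starts with this word. Every position that \<open>h\<close> sieves
  carries a zero, so \<open>h\<close> leaves at least the positions left by \<open>g\<close>, and by maximality no others. For a
  fixed prime \<open>p\<close> and \<open>n = 25 p\<^sup>4\<close> this forces \<open>h\<close> and \<open>g\<close> to agree modulo \<open>p\<^sup>2\<close>: any other residue
  class modulo \<open>p\<^sup>2\<close> contains a position not sieved by \<open>g\<close>, since the squares \<open>q\<^sup>2 \<le> n\<close> of the other
  primes remove less than the whole class (\<open>residue_class_not_sieved\<close>). Moreover \<open>h\<close> leaves exactly \<open>M n\<close>
  positions, all carrying the symbol 1, so the first \<open>M n\<close> digits of \<open>y\<close> are 1. Hence the measure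
  of the word is at most \<open>1 / p\<^sup>2 * (1/2) ^ M n\<close> (\<open>eta_maximal_word_le\<close>).

  On the other side, a word of length \<open>n\<close> is determined by subexponentially many choices of residues and
  a subset of at most \<open>M n\<close> positions, so the entropy is at most \<open>ln 2\<close> times the growth rate of \<open>M\<close>.
  As \<open>M\<close> is subadditive, this gives \<open>n h \<le> M n ln 2\<close> for the entropy \<open>h\<close> and every \<open>n \<ge> 1\<close>
  (\<open>h_top_flow_le\<close>). A Gibbs constant \<open>c\<close> would therefore satisfy \<open>c \<le> 1 / p\<^sup>2\<close> for every prime \<open>p\<close>.
\<close>

section \<open>Sieves and words\<close>

definition unsieved :: "(nat \<Rightarrow> int) \<Rightarrow> nat \<Rightarrow> nat set" where
  "unsieved g n = {k \<in> {1..n}. \<not> sieved g k}"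

definition indicator_word :: "nat \<Rightarrow> nat set \<Rightarrow> nat list" where
  "indicator_word n A = map (\<lambda>k. if k \<in> A then 1 else 0) [1..<n + 1]"

definition indicator_seq :: "nat set \<Rightarrow> nat \<Rightarrow> nat" where
  "indicator_seq A = (\<lambda>k\<in>{1..}. if k \<in> A then 1 else 0)"

definition max_ones :: "(nat \<Rightarrow> nat) set \<Rightarrow> nat \<Rightarrow> nat" where
  "max_ones X n = Max ((\<lambda>x. card (support x \<inter> {1..n})) ` X)"

text \<open>
  Setting the residue modulo \<open>p\<^sup>2\<close> to zero for \<open>p\<^sup>2 > n\<close> makes \<open>p\<close> harmless on the window \<open>{1..n}\<close>,
  which contains no positive multiple of \<open>p\<^sup>2\<close>. Only finitely many truncated systems exist for a
  given \<open>n\<close>, and each leaves as much of the window as its small primes allow.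
\<close>
definition truncate_residues :: "nat \<Rightarrow> (nat \<Rightarrow> int) \<Rightarrow> nat \<Rightarrow> int" where
  "truncate_residues n g = (\<lambda>p\<in>{p. prime p}. if p\<^sup>2 \<le> n then g p else 0)"

section \<open>The flow and the sets left over by sieves\<close>

lemma carrier_mod_square:
  "prime p \<Longrightarrow> carrier (integer_mod_group (p\<^sup>2)) = {0..<int (p\<^sup>2)}"
  by (auto simp: carrier_integer_mod_group dest: prime_gt_0_nat)

lemma carrier_G: "carrier G = (\<Pi>\<^sub>E p\<in>{p. prime p}. {0..<int (p\<^sup>2)})"
  unfolding G_def by (auto simp: carrier_mod_square intro!: PiE_cong)

lemma topspace_Omega2: "Omega2 = (\<Pi>\<^sub>E k\<in>{1..}. {0, 1})"
  by (simp add: Omega2_top_def)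

lemma topspace_G_top: "topspace G_top = carrier G"
  unfolding G_top_def carrier_G by (auto simp: carrier_mod_square intro!: PiE_cong)

lemma finite_unsieved [simp]: "finite (unsieved g n)"
  by (simp add: unsieved_def)

lemma support_indicator_seq: "support (indicator_seq A) = A \<inter> {1..}"
  by (auto simp: support_def indicator_seq_def)

lemma prefix_word_indicator_seq: "prefix_word n (indicator_seq A) = indicator_word n A"
  by (auto simp: prefix_word_def indicator_word_def indicator_seq_def)

lemma prefix_word_eq_indicator_word:
  assumes "x \<in> Omega2"
  shows "prefix_word n x = indicator_word n (support x \<inter> {1..n})"
proof -
  have "x k = (if k \<in> support x \<inter> {1..n} then 1 else 0)" if "k \<in> {1..<n+1}" for k
    using assms that by (force simp: topspace_Omega2 support_def PiE_iff)
  then show ?thesis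
    unfolding prefix_word_def indicator_word_def by (intro map_cong) auto
qed

lemma prefix_word_eq_iff: "prefix_word n x = prefix_word n z \<longleftrightarrow> (\<forall>k\<in>{1..n}. x k = z k)"
  by (force simp: prefix_word_def)

lemma length_prefix_word [simp]: "length (prefix_word n x) = n"
  by (simp add: prefix_word_def)

text \<open>
  Properness of the reduction modulo \<open>p\<^sup>2\<close> means that some residue is missed; collecting one
  missed residue for each prime gives a point of \<open>G\<close> whose sieve avoids the whole support.
\<close>
lemma squarefree_flow_iff:
  assumes "x \<in> Omega2"
  shows "x \<in> squarefree_flow \<longleftrightarrow> (\<exists>g\<in>carrier G. \<forall>k\<in>support x. \<not> sieved g k)"
proof
  assume "x \<in> squarefree_flow"
  then have "(\<lambda>n. int n mod int (p\<^sup>2)) ` support x \<subset> carrier (integer_mod_group (p\<^sup>2))" if "prime p" for p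
    using that unfolding squarefree_flow_def by blast
  then have proper: "(\<lambda>n. int n mod int (p\<^sup>2)) ` support x \<subset> {0..<int (p\<^sup>2)}" if "prime p" for p
    using that by (simp only: carrier_mod_square)
  have "\<exists>r\<in>{0..<int (p\<^sup>2)}. \<forall>k\<in>support x. int k mod int (p\<^sup>2) \<noteq> r" if "prime p" for p
    using psubset_imp_ex_mem[OF proper[OF that]] by (metis DiffE image_eqI)
  then obtain f where f: "\<And>p. prime p \<Longrightarrow> f p \<in> {0..<int (p\<^sup>2)} \<and> (\<forall>k\<in>support x. int k mod int (p\<^sup>2) \<noteq> f p)"
    by metis
  define g where "g = restrict f {p. prime p}"
  have "g \<in> carrier G"
    using f by (auto simp: carrier_G g_def)
  moreover have "\<not> sieved g k" if "k \<in> support x" for k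
    using f that by (auto simp: sieved_def g_def cong_def)
  ultimately show "\<exists>g\<in>carrier G. \<forall>k\<in>support x. \<not> sieved g k"
    by blast
next
  assume "\<exists>g\<in>carrier G. \<forall>k\<in>support x. \<not> sieved g k"
  then obtain g where g: "g \<in> carrier G" and ns: "\<And>k. k \<in> support x \<Longrightarrow> \<not> sieved g k"
    by blast
  have "(\<lambda>n. int n mod int (p\<^sup>2)) ` support x \<subset> {0..<int (p\<^sup>2)}" if p: "prime p" for p
  proof
    show "(\<lambda>n. int n mod int (p\<^sup>2)) ` support x \<subseteq> {0..<int (p\<^sup>2)}"
      using prime_gt_0_nat[OF p] by (auto simp del: of_nat_power)
    have gp: "g p \<in> {0..<int (p\<^sup>2)}"
      using g p by (auto simp: carrier_G simp del: of_nat_power)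
    have "g p \<noteq> int k mod int (p\<^sup>2)" if "k \<in> support x" for k
      using ns[OF that] p unfolding sieved_def cong_def by (metis mod_mod_trivial)
    with gp show "(\<lambda>n. int n mod int (p\<^sup>2)) ` support x \<noteq> {0..<int (p\<^sup>2)}"
      by blast
  qed
  then have "(\<lambda>n. int n mod int (p\<^sup>2)) ` support x \<subset> carrier (integer_mod_group (p\<^sup>2))" if "prime p" for p
    using that by (simp only: carrier_mod_square)
  then show "x \<in> squarefree_flow"
    using assms unfolding squarefree_flow_def by blast
qed

lemma indicator_seq_unsieved_in_flow:
  assumes "g \<in> carrier G"
  shows "indicator_seq (unsieved g n) \<in> squarefree_flow"
proof -
  have "indicator_seq (unsieved g n) \<in> Omega2"
    by (auto simp: topspace_Omega2 indicator_seq_def)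
  then show ?thesis
    using assms by (auto simp: squarefree_flow_iff support_indicator_seq unsieved_def)
qed

lemma truncate_in_carrier:
  assumes "g \<in> carrier G" shows "truncate_residues n g \<in> carrier G"
  using assms by (auto simp: carrier_G truncate_residues_def prime_gt_0_nat PiE_iff)

lemma sieved_truncate_iff:
  assumes "k \<in> {1..n}"
  shows "sieved (truncate_residues n g) k \<longleftrightarrow> (\<exists>p. prime p \<and> p\<^sup>2 \<le> n \<and> [int k = g p] (mod int (p\<^sup>2)))"
proof -
  have "\<not> [int k = 0] (mod int (p\<^sup>2))" if "\<not> p\<^sup>2 \<le> n" for p :: nat
    using assms that by (auto simp: cong_0_iff simp del: of_nat_power dest!: dvd_imp_le)
  then show ?thesis
    by (auto simp: sieved_def truncate_residues_def)
qed

lemma unsieved_subset_truncate: "unsieved g n \<subseteq> unsieved (truncate_residues n g) n"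
  by (auto simp: unsieved_def sieved_truncate_iff) (auto simp: sieved_def)

lemma finite_ones_image: "finite ((\<lambda>x. card (support x \<inter> {1..n})) ` X)"
proof (rule finite_subset)
  show "(\<lambda>x. card (support x \<inter> {1..n})) ` X \<subseteq> {..n}"
    using card_mono[of "{1..n}" "support x \<inter> {1..n}" for x] by auto
qed simp

lemma ones_le_max_ones:
  "x \<in> X \<Longrightarrow> card (support x \<inter> {1..n}) \<le> max_ones X n"
  unfolding max_ones_def using finite_ones_image by (intro Max_ge) auto

lemma max_ones_attained:
  assumes "X \<noteq> {}"
  obtains x where "x \<in> X" "card (support x \<inter> {1..n}) = max_ones X n"
proof -
  have "max_ones X n \<in> (\<lambda>x. card (support x \<inter> {1..n})) ` X"
    unfolding max_ones_def using assms finite_ones_image by (intro Max_in) auto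
  then show ?thesis using that by (metis (no_types, lifting) imageE)
qed

text \<open>
  The set left over by a sieve is itself the support of a point of the flow.
\<close>
lemma card_unsieved_le:
  assumes "g \<in> carrier G"
  shows "card (unsieved g n) \<le> max_ones squarefree_flow n"
proof -
  have "unsieved g n = support (indicator_seq (unsieved g n)) \<inter> {1..n}"
    by (auto simp: support_indicator_seq unsieved_def)
  then show ?thesis
    using ones_le_max_ones[OF indicator_seq_unsieved_in_flow[OF assms, of n], of n] by simp
qed

lemma flow_subset_Omega2: "squarefree_flow \<subseteq> Omega2"
  by (auto simp: squarefree_flow_def)

lemma carrier_G_nonempty: "carrier G \<noteq> {}"
proof -
  have "(\<lambda>p\<in>{p. prime p}. 0) \<in> carrier G"
    by (auto simp: carrier_G prime_gt_0_nat)
  then show ?thesis by blast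
qed

lemma flow_nonempty: "squarefree_flow \<noteq> {}"
  using carrier_G_nonempty indicator_seq_unsieved_in_flow by blast

lemma flow_support_unsieved:
  assumes "x \<in> squarefree_flow"
  obtains g where "g \<in> carrier G" "support x \<inter> {1..n} \<subseteq> unsieved (truncate_residues n g) n"
proof -
  obtain g where g: "g \<in> carrier G" "\<And>k. k \<in> support x \<Longrightarrow> \<not> sieved g k"
    using assms flow_subset_Omega2 squarefree_flow_iff by blast
  then have "support x \<inter> {1..n} \<subseteq> unsieved g n"
    by (auto simp: unsieved_def)
  with g that unsieved_subset_truncate show ?thesis
    by blast
qed

text \<open>
  A support of maximal size in the window is contained in a set left over by a truncated sieve,
  so the latter is maximal as well. Maximal words can thus be taken to be complements of sieves,
  which is what makes them rigid.
\<close>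
lemma max_ones_attained_by_sieve:
  obtains g where "g \<in> carrier G"
    "card (unsieved (truncate_residues n g) n) = max_ones squarefree_flow n"
proof -
  obtain x where x: "x \<in> squarefree_flow"
    "card (support x \<inter> {1..n}) = max_ones squarefree_flow n"
    using max_ones_attained flow_nonempty by metis
  obtain g where g: "g \<in> carrier G" "support x \<inter> {1..n} \<subseteq> unsieved (truncate_residues n g) n"
    using flow_support_unsieved x(1) by metis
  have "card (unsieved (truncate_residues n g) n) = max_ones squarefree_flow n"
    using card_mono[OF finite_unsieved g(2)] x(2)
      card_unsieved_le[OF truncate_in_carrier[OF g(1)], of n n] by simp
  with g(1) that show ?thesis by blast
qed

section \<open>A residue class survives the sieve\<close>

text \<open>
  The sum of \<open>1 / q\<^sup>2\<close> over all \<open>q \<ge> 2\<close> is less than 1, with room to spare: this is why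
  finitely many distinct prime squares cannot sieve out a long progression. The telescoping tail \<open>1 / m\<close>
  is what makes the induction work.
\<close>
lemma sum_inverse_squares_le:
  "m \<ge> 2 \<Longrightarrow> (\<Sum>q=2..m. 1 / (real q)\<^sup>2) \<le> 3/4 - 1 / real m"
proof (induction m rule: dec_induct)
  case (step m)
  have "1 / (real (Suc m))\<^sup>2 \<le> 1 / (real m * real (Suc m))"
    using \<open>2 \<le> m\<close> by (intro divide_left_mono) (auto simp: power2_eq_square)
  also have "\<dots> = 1 / real m - 1 / real (Suc m)"
    using \<open>2 \<le> m\<close> by (simp add: field_simps)
  finally have "1 / (real (Suc m))\<^sup>2 \<le> 1 / real m - 1 / real (Suc m)" .
  with step show ?case by simp
qed (simp add: power2_eq_square)

lemma card_congruent_le: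
  assumes Q: "Q > 0" and J: "J \<subseteq> {..<T}"
    and cong: "\<And>i j. i \<in> J \<Longrightarrow> j \<in> J \<Longrightarrow> [i = j] (mod Q)"
  shows "real (card J) \<le> real T / real Q + 1"
proof -
  have "inj_on (\<lambda>j. j div Q) J"
  proof (rule inj_onI)
    fix i j assume "i \<in> J" "j \<in> J" "i div Q = j div Q"
    then show "i = j"
      using cong[of i j] unfolding cong_def by (metis div_mult_mod_eq)
  qed
  moreover have "(\<lambda>j. j div Q) ` J \<subseteq> {..T div Q}"
    using J by (auto intro!: div_le_mono)
  ultimately have "card J \<le> T div Q + 1"
    using card_inj_on_le[of "\<lambda>j. j div Q" J "{..T div Q}"] by simp
  also have "real (T div Q + 1) \<le> real T / real Q + 1"
    using of_nat_div_le_of_nat[of T Q] by simp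
  finally show ?thesis by simp
qed

text \<open>
  A residue class modulo \<open>p\<^sup>2\<close> other than the one removed by \<open>g\<close> itself has \<open>T = 25 p\<^sup>2\<close> members in
  the window. A prime \<open>q \<noteq> p\<close> removes at most \<open>T / q\<^sup>2 + 1\<close> of them, and only the primes \<open>q \<le> 5 p\<^sup>2\<close>
  take part, so at most \<open>3/4 T + 5 p\<^sup>2 < T\<close> members disappear. The factor 25 in \<open>n\<close> is chosen
  so that this last inequality holds.
\<close>
lemma residue_class_not_sieved:
  assumes p: "prime p" and n: "n = 25 * p ^ 4" and r: "\<not> [r = g p] (mod int (p\<^sup>2))"
  shows "\<exists>k\<in>unsieved (truncate_residues n g) n. [int k = r] (mod int (p\<^sup>2))"
proof (rule ccontr)
  assume none: "\<not> ?thesis"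
  define T where "T = 25 * p\<^sup>2"
  \<comment> \<open>the least positive member of the residue class\<close>
  define a where "a = 1 + nat ((r - 1) mod int (p\<^sup>2))"
  have p0: "p > 0" using prime_gt_0_nat[OF p] .
  then have p2: "int (p\<^sup>2) > 0" by simp
  have "[1 + (r - 1) mod int (p\<^sup>2) = 1 + (r - 1)] (mod int (p\<^sup>2))"
    by (intro cong_add) (auto simp: cong_def)
  then have a: "[int a = r] (mod int (p\<^sup>2))"
    using p2 by (simp add: a_def del: of_nat_power)
  have "(r - 1) mod int (p\<^sup>2) < int (p\<^sup>2)"
    using p2 by (rule pos_mod_bound)
  then have a_le: "1 \<le> a" "a \<le> p\<^sup>2"
    using p2 pos_mod_sign[OF p2, of "r - 1"] unfolding a_def by linarith+
  \<comment> \<open>\<open>J q\<close> indexes the members of the class that the prime \<open>q\<close> removes.\<close>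
  define J where "J q = {j \<in> {..<T}. [int (a + p\<^sup>2 * j) = g q] (mod int (q\<^sup>2))}" for q
  have n_T: "n = p\<^sup>2 * T"
    by (simp add: n T_def power2_eq_square power4_eq_xxxx)
  have in_class: "[int (a + p\<^sup>2 * j) = r] (mod int (p\<^sup>2))" for j
    using a by (simp add: cong_def)
  have range: "a + p\<^sup>2 * j \<in> {1..n}" if "j < T" for j
  proof -
    have "a + p\<^sup>2 * j \<le> p\<^sup>2 * Suc j" using a_le by simp
    also have "\<dots> \<le> p\<^sup>2 * T" using that by (intro mult_le_mono) auto
    finally show ?thesis using a_le n_T by simp
  qed
  have cover: "\<exists>q\<in>{2..5 * p\<^sup>2} \<inter> {q. prime q \<and> q \<noteq> p}. j \<in> J q" if j: "j < T" for j
  proof -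
    have "a + p\<^sup>2 * j \<notin> unsieved (truncate_residues n g) n"
      using none in_class by blast
    then have "sieved (truncate_residues n g) (a + p\<^sup>2 * j)"
      using range[OF j] by (simp add: unsieved_def)
    then obtain q where q: "prime q" "q\<^sup>2 \<le> n" "[int (a + p\<^sup>2 * j) = g q] (mod int (q\<^sup>2))"
      using sieved_truncate_iff range[OF j] by blast
    have "q \<noteq> p"
      using q(3) in_class[of j] r cong_sym cong_trans by blast
    have "q\<^sup>2 \<le> (5 * p\<^sup>2)\<^sup>2"
      using q(2) by (simp add: n power2_eq_square power4_eq_xxxx)
    then have "q \<le> 5 * p\<^sup>2"
      by (rule power2_le_imp_le) simp
    with q \<open>q \<noteq> p\<close> j show ?thesis
      using prime_ge_2_nat[OF q(1)] by (auto simp: J_def)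
  qed
  have card_J: "real (card (J q)) \<le> real T / real (q\<^sup>2) + 1" if q: "prime q" "q \<noteq> p" for q
  proof (rule card_congruent_le)
    show "q\<^sup>2 > 0" using prime_gt_0_nat[OF q(1)] by simp
    show "J q \<subseteq> {..<T}" by (auto simp: J_def)
    fix i j assume "i \<in> J q" "j \<in> J q"
    then have "[int (a + p\<^sup>2 * i) = int (a + p\<^sup>2 * j)] (mod int (q\<^sup>2))"
      unfolding J_def using cong_sym cong_trans by blast
    then have "[p\<^sup>2 * i = p\<^sup>2 * j] (mod q\<^sup>2)"
      by (simp only: cong_int_iff cong_add_lcancel_nat)
    moreover have "coprime (p\<^sup>2) (q\<^sup>2)"
      using primes_coprime[OF p q(1)] q(2) by auto
    ultimately show "[i = j] (mod q\<^sup>2)"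
      by (simp add: cong_mult_lcancel_nat)
  qed
  let ?Q = "{2..5 * p\<^sup>2} \<inter> {q. prime q \<and> q \<noteq> p}"
  have "p\<^sup>2 \<ge> 1"
    using p0 by simp
  then have p_ge: "(2::nat) \<le> 5 * p\<^sup>2"
    by linarith
  have "{..<T} \<subseteq> (\<Union>q\<in>?Q. J q)"
    using cover by blast
  then have "card {..<T} \<le> card (\<Union>q\<in>?Q. J q)"
    by (intro card_mono) (auto simp: J_def)
  also have "\<dots> \<le> (\<Sum>q\<in>?Q. card (J q))"
    by (intro card_UN_le) simp
  finally have "real T \<le> (\<Sum>q\<in>?Q. real (card (J q)))"
    by (simp flip: of_nat_sum)
  also have "\<dots> \<le> (\<Sum>q\<in>?Q. real T / real (q\<^sup>2) + 1)"
    using card_J by (intro sum_mono) auto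
  also have "\<dots> \<le> (\<Sum>q=2..5 * p\<^sup>2. real T / real (q\<^sup>2) + 1)"
    by (intro sum_mono2) auto
  also have "\<dots> = real T * (\<Sum>q=2..5 * p\<^sup>2. 1 / (real q)\<^sup>2) + real (card {2..5 * p\<^sup>2})"
    by (simp add: sum.distrib sum_distrib_left)
  also have "\<dots> \<le> real T * (3/4) + real (5 * p\<^sup>2)"
  proof (intro add_mono mult_left_mono)
    have "0 \<le> 1 / real (5 * p\<^sup>2)" by simp
    then show "(\<Sum>q=2..5 * p\<^sup>2. 1 / (real q)\<^sup>2) \<le> 3/4"
      using sum_inverse_squares_le[OF p_ge] by linarith
  qed (simp_all del: of_nat_power of_nat_mult)
  also have "\<dots> < real T"
    using p0 by (simp add: T_def)
  finally show False by simp
qed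

section \<open>Entropy is bounded by the growth of the number of words\<close>

lemma shift_power_apply: "k \<ge> 1 \<Longrightarrow> (shift ^^ i) x k = x (k + i)"
  by (induction i arbitrary: k) (auto simp: shift_def)

lemma subshift_subset: "subshift X \<Longrightarrow> X \<subseteq> Omega2"
  by (auto simp: subshift_def dest: closedin_subset)

lemma subshift_shift_power:
  "subshift X \<Longrightarrow> x \<in> X \<Longrightarrow> (shift ^^ i) x \<in> X"
  by (induction i) (auto simp: subshift_def)

lemma cylinder_prefix_word:
  "cylinder X (prefix_word n x) = {z \<in> X. \<forall>k\<in>{1..n}. z k = x k}"
  by (auto simp: cylinder_def prefix_word_eq_iff)

lemma finite_words:
  assumes "X \<subseteq> Omega2" shows "finite (words X n)"
proof (rule finite_subset)
  show "words X n \<subseteq> {w. set w \<subseteq> {0, 1} \<and> length w = n}"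
  proof
    fix w assume "w \<in> words X n"
    then obtain x where x: "x \<in> X" "w = prefix_word n x"
      by (auto simp: words_def)
    have "x ` {1..<n + 1} \<subseteq> {0, 1}"
      using x(1) assms by (force simp: topspace_Omega2 PiE_iff)
    then show "w \<in> {w. set w \<subseteq> {0, 1} \<and> length w = n}"
      unfolding x(2) by (simp add: prefix_word_def del: upt_Suc)
  qed
  show "finite {w. set w \<subseteq> {0, 1::nat} \<and> length w = n}"
    by (intro finite_lists_length_eq) simp
qed

lemma compact_Omega2: "compact_space Omega2_top"
  unfolding Omega2_top_def by (simp add: compact_space_product_topology compact_space_discrete_topology)

lemma openin_cylinder:
  assumes "X \<subseteq> Omega2" "x \<in> Omega2"
  shows "openin (subtopology Omega2_top X) (cylinder X (prefix_word n x))"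
proof -
  define V where "V k = (if k \<le> n then {x k} else {0, 1})" for k
  have "openin Omega2_top (Pi\<^sub>E {1..} V)"
    unfolding Omega2_top_def
  proof (subst openin_PiE_gen, intro disjI2 conjI ballI)
    show "finite {k \<in> {1..}. V k \<noteq> topspace (discrete_topology {0, 1})}"
      by (rule finite_subset[of _ "{..n}"]) (auto simp: V_def)
    show "openin (discrete_topology {0, 1}) (V k)" if "k \<in> {1..}" for k
      using assms(2) that by (auto simp: V_def topspace_Omega2 PiE_iff)
  qed
  moreover have "cylinder X (prefix_word n x) = Pi\<^sub>E {1..} V \<inter> X"
    using assms(1)
    by (force simp: cylinder_prefix_word V_def topspace_Omega2 PiE_iff split: if_splits)
  ultimately show ?thesis
    by (auto simp: openin_subtopology)
qed

lemma open_contains_cylinder: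
  assumes X: "X \<subseteq> Omega2" and U: "openin (subtopology Omega2_top X) U" and x: "x \<in> U"
  obtains n where "cylinder X (prefix_word n x) \<subseteq> U"
proof -
  obtain W where W: "openin Omega2_top W" "U = W \<inter> X"
    using U by (auto simp: openin_subtopology)
  then obtain V where V: "finite {k \<in> {1..}. V k \<noteq> {0, 1}}" "x \<in> Pi\<^sub>E {1..} V" "Pi\<^sub>E {1..} V \<subseteq> W"
    using x unfolding Omega2_top_def openin_product_topology_alt by fastforce
  obtain n where n: "\<And>k. k \<in> {1..} \<Longrightarrow> V k \<noteq> {0, 1} \<Longrightarrow> k \<le> n"
    using V(1) unfolding finite_nat_set_iff_bounded_le by blast
  have "z \<in> U" if z: "z \<in> cylinder X (prefix_word n x)" for z
  proof -
    have zX: "z \<in> X" "z \<in> Omega2" and eq: "\<And>k. k \<in> {1..n} \<Longrightarrow> z k = x k"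
      using z X by (auto simp: cylinder_prefix_word)
    have "z k \<in> V k" if "k \<in> {1..}" for k
    proof (cases "V k = {0, 1}")
      case True
      then show ?thesis using zX(2) that by (auto simp: topspace_Omega2 PiE_iff)
    next
      case False
      then show ?thesis using n[OF that False] eq[of k] V(2) that by (auto simp: PiE_iff)
    qed
    then have "z \<in> Pi\<^sub>E {1..} V"
      using zX(2) by (auto simp: topspace_Omega2 PiE_iff)
    then show ?thesis using V(3) W(2) zX(1) by blast
  qed
  then show ?thesis using that by blast
qed

text \<open>
  The Lebesgue number lemma for subshifts: cylinders are a basis of open sets, and by compactness
  finitely many of them suffice to refine the cover, so a common length works.
\<close>
lemma open_cover_refined_by_cylinders:
  assumes X: "closedin Omega2_top X" and \<U>: "open_cover (subtopology Omega2_top X) \<U>"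
  obtains L where "\<And>x. x \<in> X \<Longrightarrow> \<exists>U\<in>\<U>. cylinder X (prefix_word L x) \<subseteq> U"
proof -
  let ?T = "subtopology Omega2_top X"
  have sub: "X \<subseteq> Omega2" using X by (rule closedin_subset)
  then have top: "topspace ?T = X" by auto
  have "\<exists>l. \<exists>U\<in>\<U>. cylinder X (prefix_word l x) \<subseteq> U" if "x \<in> X" for x
    using \<U> that open_contains_cylinder[OF sub] top unfolding open_cover_def by (metis UnionE)
  then obtain l where l: "\<And>x. x \<in> X \<Longrightarrow> \<exists>U\<in>\<U>. cylinder X (prefix_word (l x) x) \<subseteq> U"
    by metis
  define C where "C x = cylinder X (prefix_word (l x) x)" for x
  have "compact_space ?T"
    using closedin_compact_space[OF compact_Omega2 X] by (rule compact_space_subtopology)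
  moreover have "\<forall>U\<in>C ` X. openin ?T U"
    using openin_cylinder[OF sub] sub by (auto simp: C_def)
  moreover have "topspace ?T \<subseteq> \<Union> (C ` X)"
    unfolding top by (auto simp: C_def cylinder_def)
  ultimately obtain \<F> where "finite \<F>" "\<F> \<subseteq> C ` X" "X \<subseteq> \<Union>\<F>"
    unfolding compact_space_alt top by meson
  then obtain Y where Y: "Y \<subseteq> X" "finite Y" "X \<subseteq> (\<Union>y\<in>Y. C y)"
    by (metis finite_subset_image)
  obtain L where L: "\<And>y. y \<in> Y \<Longrightarrow> l y \<le> L"
    using Y(2) finite_nat_set_iff_bounded_le[of "l ` Y"] by auto
  have "\<exists>U\<in>\<U>. cylinder X (prefix_word L x) \<subseteq> U" if x: "x \<in> X" for x
  proof -
    obtain y where y: "y \<in> Y" "x \<in> C y" using Y(3) x by blast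
    have "cylinder X (prefix_word L x) \<subseteq> C y"
      using y(2) L[OF y(1)] by (auto simp: C_def cylinder_prefix_word)
    then show ?thesis
      using l y(1) Y(1) unfolding C_def by (meson subset_eq)
  qed
  then show ?thesis using that by blast
qed

text \<open>
  A cylinder of length \<open>n + L\<close> determines the first \<open>L\<close> symbols of each of the first \<open>n\<close> shifts, hence
  lies in a single member of the iterated cover.
\<close>
lemma min_subcover_iterated_le:
  assumes X: "subshift X"
    and L: "\<And>x. x \<in> X \<Longrightarrow> \<exists>U\<in>\<U>. cylinder X (prefix_word L x) \<subseteq> U"
  shows "min_subcover (subtopology Omega2_top X)
           (iterated_cover (subtopology Omega2_top X) shift \<U> n) \<le> card (words X (n + L))"
proof -
  let ?T = "subtopology Omega2_top X"
  have sub: "X \<subseteq> Omega2" using X by (rule subshift_subset)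
  then have top: "topspace ?T = X" by auto
  have "\<exists>u. (\<forall>i<n. u i \<in> \<U>) \<and> (\<forall>z\<in>cylinder X w. \<forall>i<n. (shift ^^ i) z \<in> u i)"
    if w: "w \<in> words X (n + L)" for w
  proof -
    obtain x where x: "x \<in> X" "w = prefix_word (n + L) x"
      using w by (auto simp: words_def)
    have "\<exists>U. U \<in> \<U> \<and> cylinder X (prefix_word L ((shift ^^ i) x)) \<subseteq> U" for i
      using L[OF subshift_shift_power[OF X x(1)]] by blast
    then obtain u where u: "\<And>i. u i \<in> \<U> \<and> cylinder X (prefix_word L ((shift ^^ i) x)) \<subseteq> u i"
      by metis
    have "(shift ^^ i) z \<in> u i" if "z \<in> cylinder X w" "i < n" for z i
    proof -
      have "(shift ^^ i) z \<in> cylinder X (prefix_word L ((shift ^^ i) x))"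
        using that subshift_shift_power[OF X]
        by (auto simp: x cylinder_prefix_word shift_power_apply)
      then show ?thesis using u by blast
    qed
    with u show ?thesis by blast
  qed
  then obtain u where u: "\<And>w. w \<in> words X (n + L) \<Longrightarrow>
      (\<forall>i<n. u w i \<in> \<U>) \<and> (\<forall>z\<in>cylinder X w. \<forall>i<n. (shift ^^ i) z \<in> u w i)"
    by metis
  define F where "F w = {x \<in> topspace ?T. \<forall>i<n. (shift ^^ i) x \<in> u w i}" for w
  let ?V = "F ` words X (n + L)"
  have fin: "finite (words X (n + L))" using finite_words[OF sub] .
  have V_sub: "?V \<subseteq> iterated_cover ?T shift \<U> n"
    using u unfolding iterated_cover_def F_def by blast
  have V_cover: "\<Union>?V = topspace ?T"
  proof
    show "topspace ?T \<subseteq> \<Union>?V"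
    proof
      fix x assume "x \<in> topspace ?T"
      then have x: "x \<in> X" using top by simp
      then have w: "prefix_word (n + L) x \<in> words X (n + L)"
        "x \<in> cylinder X (prefix_word (n + L) x)"
        by (auto simp: words_def cylinder_def)
      then have "x \<in> F (prefix_word (n + L) x)"
        using u x top by (auto simp: F_def)
      with w show "x \<in> \<Union>?V" by blast
    qed
  qed (auto simp: F_def)
  have "min_subcover ?T (iterated_cover ?T shift \<U> n) \<le> card ?V"
    unfolding min_subcover_def
    by (rule Least_le) (use V_sub V_cover fin in blast)
  also have "\<dots> \<le> card (words X (n + L))"
    using fin by (rule card_image_le)
  finally show ?thesis .
qed

text \<open>
  The majorant \<open>f\<close> may be evaluated at \<open>n + L\<close> for every fixed \<open>L\<close>: this absorbs the Lebesgue
  number of the cover, which varies with the cover.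
\<close>
lemma h_top_le_word_growth:
  assumes X: "subshift X"
    and f: "\<And>n. ln (real (card (words X n))) \<le> f n"
    and lim: "\<And>L. (\<lambda>n. f (n + L) / real n) \<longlonglongrightarrow> \<beta>"
  shows "h_top X \<le> \<beta>"
proof -
  let ?T = "subtopology Omega2_top X"
  have ln_nat_nonneg: "0 \<le> ln (real j)" for j by (cases j) auto
  \<comment> \<open>Passing to the reals turns an entropy of \<open>-\<infinity>\<close> into 0, so nonnegativity of the bound is used.\<close>
  have "0 \<le> \<beta>"
  proof (rule LIMSEQ_le_const[OF lim[of 0]])
    show "\<exists>N. \<forall>n\<ge>N. 0 \<le> f (n + 0) / real n"
      using order_trans[OF ln_nat_nonneg f] by auto
  qed
  have "cover_entropy ?T shift \<U> \<le> ereal \<beta>" if \<U>: "open_cover ?T \<U>" for \<U>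
  proof -
    obtain L where L: "\<And>x. x \<in> X \<Longrightarrow> \<exists>U\<in>\<U>. cylinder X (prefix_word L x) \<subseteq> U"
      using open_cover_refined_by_cylinders X \<U> unfolding subshift_def by metis
    have "ln (real (min_subcover ?T (iterated_cover ?T shift \<U> n))) \<le> f (n + L)" for n
    proof (cases "min_subcover ?T (iterated_cover ?T shift \<U> n) = 0")
      case True
      then show ?thesis using order_trans[OF ln_nat_nonneg f] by simp
    next
      case False
      moreover have "min_subcover ?T (iterated_cover ?T shift \<U> n) \<le> card (words X (n + L))"
        using X L by (rule min_subcover_iterated_le)
      ultimately have "ln (real (min_subcover ?T (iterated_cover ?T shift \<U> n)))
          \<le> ln (real (card (words X (n + L))))"
        by (intro ln_mono) auto
      from order_trans[OF this f] show ?thesis .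
    qed
    then have "cover_entropy ?T shift \<U> \<le> limsup (\<lambda>n. ereal (f (n + L) / real n))"
      unfolding cover_entropy_def
      by (intro Limsup_mono always_eventually allI) (simp add: divide_right_mono)
    also have "\<dots> = ereal \<beta>"
      using lim[of L] by (intro lim_imp_Limsup) auto
    finally show ?thesis .
  qed
  then have "topological_entropy ?T shift \<le> ereal \<beta>"
    unfolding topological_entropy_def by (auto intro: SUP_least)
  with \<open>0 \<le> \<beta>\<close> show ?thesis
    unfolding h_top_def by (cases "topological_entropy ?T shift") auto
qed

section \<open>The entropy of the squarefree flow\<close>

lemma card_truncations_le:
  "finite (truncate_residues n ` carrier G)" "card (truncate_residues n ` carrier G) \<le> n ^ card {p. prime p \<and> p\<^sup>2 \<le> n}"
proof -
  let ?P = "{p. prime p \<and> p\<^sup>2 \<le> n}"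
  let ?R = "\<Pi>\<^sub>E p\<in>?P. {0..<int (p\<^sup>2)}"
  have "?P \<subseteq> {..n}"
    using power2_nat_le_imp_le by auto
  then have P: "finite ?P"
    by (rule finite_subset) simp
  then have finR: "finite ?R"
    by (intro finite_PiE) auto
  have sub: "truncate_residues n ` carrier G \<subseteq> truncate_residues n ` ?R"
  proof
    fix h assume "h \<in> truncate_residues n ` carrier G"
    then obtain g where g: "g \<in> carrier G" "h = truncate_residues n g" by blast
    have "truncate_residues n g = truncate_residues n (restrict g ?P)"
      by (auto simp: truncate_residues_def)
    moreover have "restrict g ?P \<in> ?R"
      using g(1) by (auto simp: carrier_G PiE_iff simp del: of_nat_power)
    ultimately show "h \<in> truncate_residues n ` ?R" using g(2) by blast
  qed
  then show "finite (truncate_residues n ` carrier G)"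
    using finR finite_surj by blast
  have "card (truncate_residues n ` carrier G) \<le> card (truncate_residues n ` ?R)"
    using sub finR by (intro card_mono) auto
  also have "\<dots> \<le> card ?R" using finR by (rule card_image_le)
  also have "\<dots> = (\<Prod>p\<in>?P. p\<^sup>2)" using P by (simp add: card_PiE del: of_nat_power)
  also have "\<dots> \<le> (\<Prod>p\<in>?P. n)" by (intro prod_mono) auto
  also have "\<dots> = n ^ card ?P" by simp
  finally show "card (truncate_residues n ` carrier G) \<le> n ^ card ?P" .
qed

text \<open>
  A word of the flow is given by the residues it misses modulo the squares \<open>p\<^sup>2 \<le> n\<close>, together with a
  subset of the positions left over by the corresponding sieve. The number of choices of residues is
  subexponential in \<open>n\<close>, and the number of positions is at most \<open>max_ones squarefree_flow n\<close>.
\<close>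
lemma card_words_flow_le:
  "card (words squarefree_flow n)
     \<le> n ^ card {p. prime p \<and> p\<^sup>2 \<le> n} * 2 ^ max_ones squarefree_flow n"
proof -
  let ?H = "truncate_residues n ` carrier G"
  let ?W = "\<lambda>h. indicator_word n ` Pow (unsieved h n)"
  have "words squarefree_flow n \<subseteq> (\<Union>h\<in>?H. ?W h)"
  proof
    fix w assume "w \<in> words squarefree_flow n"
    then obtain x where x: "x \<in> squarefree_flow" "w = prefix_word n x"
      by (auto simp: words_def)
    obtain g where "g \<in> carrier G" "support x \<inter> {1..n} \<subseteq> unsieved (truncate_residues n g) n"
      using flow_support_unsieved x(1) by metis
    moreover have "w = indicator_word n (support x \<inter> {1..n})"
      using x flow_subset_Omega2 prefix_word_eq_indicator_word by blast
    ultimately show "w \<in> (\<Union>h\<in>?H. ?W h)" by blast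
  qed
  then have "card (words squarefree_flow n) \<le> card (\<Union>h\<in>?H. ?W h)"
    using card_truncations_le(1) by (intro card_mono finite_UN_I) simp_all
  also have "\<dots> \<le> (\<Sum>h\<in>?H. card (?W h))"
    using card_truncations_le(1) by (rule card_UN_le)
  also have "\<dots> \<le> (\<Sum>h\<in>?H. 2 ^ max_ones squarefree_flow n)"
  proof (rule sum_mono)
    fix h assume h: "h \<in> ?H"
    have "card (?W h) \<le> card (Pow (unsieved h n))"
      by (rule card_image_le) simp
    also have "\<dots> = 2 ^ card (unsieved h n)" by (simp add: card_Pow)
    also have "\<dots> \<le> 2 ^ max_ones squarefree_flow n"
      using h by (intro power_increasing card_unsieved_le) (auto intro: truncate_in_carrier)
    finally show "card (?W h) \<le> 2 ^ max_ones squarefree_flow n" .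
  qed
  also have "\<dots> = card ?H * 2 ^ max_ones squarefree_flow n" by simp
  also have "\<dots> \<le> n ^ card {p. prime p \<and> p\<^sup>2 \<le> n} * 2 ^ max_ones squarefree_flow n"
    using card_truncations_le(2) by (rule mult_le_mono1)
  finally show ?thesis .
qed

lemma ln_card_words_flow_le:
  "ln (real (card (words squarefree_flow n)))
     \<le> sqrt (real n) * ln (real n) + real (max_ones squarefree_flow n) * ln 2"
proof (cases "n = 0")
  case True
  have "words squarefree_flow 0 = {[]}"
    using flow_nonempty by (auto simp: words_def prefix_word_def)
  then show ?thesis using True by simp
next
  case False
  let ?P = "{p. prime p \<and> p\<^sup>2 \<le> n}"
  have "?P \<subseteq> {1..nat \<lfloor>sqrt (real n)\<rfloor>}"
    using prime_ge_1_nat by (auto simp: real_le_rsqrt simp flip: of_nat_power intro!: le_nat_floor)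
  then have "card ?P \<le> nat \<lfloor>sqrt (real n)\<rfloor>"
    using card_mono[of "{1..nat \<lfloor>sqrt (real n)\<rfloor>}" ?P] by simp
  also have "real (nat \<lfloor>sqrt (real n)\<rfloor>) \<le> sqrt (real n)" by simp
  finally have P: "real (card ?P) \<le> sqrt (real n)" by simp
  have "words squarefree_flow n \<noteq> {}"
    using flow_nonempty by (auto simp: words_def)
  then have "card (words squarefree_flow n) > 0"
    using finite_words[OF flow_subset_Omega2] by (simp add: card_gt_0_iff)
  then have "ln (real (card (words squarefree_flow n)))
      \<le> ln (real (n ^ card ?P * 2 ^ max_ones squarefree_flow n))"
    using card_words_flow_le[of n] False by (intro ln_mono) (auto simp del: of_nat_mult of_nat_power)
  also have "\<dots> = real (card ?P) * ln (real n) + real (max_ones squarefree_flow n) * ln 2"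
    using False by (simp add: ln_mult ln_realpow)
  also have "\<dots> \<le> sqrt (real n) * ln (real n) + real (max_ones squarefree_flow n) * ln 2"
    using P False by (intro add_mono mult_right_mono) auto
  finally show ?thesis .
qed

lemma max_ones_0 [simp]: "X \<noteq> {} \<Longrightarrow> max_ones X 0 = 0"
  by (simp add: max_ones_def image_constant_conv)

lemma max_ones_mono:
  assumes "X \<noteq> {}" "a \<le> b" shows "max_ones X a \<le> max_ones X b"
proof -
  obtain x where x: "x \<in> X" "card (support x \<inter> {1..a}) = max_ones X a"
    using max_ones_attained assms(1) by metis
  have "card (support x \<inter> {1..a}) \<le> card (support x \<inter> {1..b})"
    using assms(2) by (intro card_mono) auto
  with x ones_le_max_ones[OF x(1), of b] show ?thesis by simp
qed

text \<open>
  The last \<open>b\<close> symbols of a window of length \<open>a + b\<close> form the initial window of a shifted point.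
\<close>
lemma max_ones_add_le:
  assumes X: "subshift X" "X \<noteq> {}"
  shows "max_ones X (a + b) \<le> max_ones X a + max_ones X b"
proof -
  obtain x where x: "x \<in> X" "card (support x \<inter> {1..a + b}) = max_ones X (a + b)"
    using max_ones_attained X(2) by metis
  have "support x \<inter> {1..a + b} \<subseteq> (support x \<inter> {1..a}) \<union> (\<lambda>k. k + a) ` (support ((shift ^^ a) x) \<inter> {1..b})"
  proof
    fix k assume k: "k \<in> support x \<inter> {1..a + b}"
    show "k \<in> (support x \<inter> {1..a}) \<union> (\<lambda>k. k + a) ` (support ((shift ^^ a) x) \<inter> {1..b})"
    proof (cases "k \<le> a")
      case False
      then have "k - a \<in> support ((shift ^^ a) x) \<inter> {1..b}"
        using k by (auto simp: support_def shift_power_apply)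
      then have "k - a + a \<in> (\<lambda>k. k + a) ` (support ((shift ^^ a) x) \<inter> {1..b})"
        by (rule imageI)
      with False show ?thesis by simp
    qed (use k in auto)
  qed
  then have "max_ones X (a + b) \<le> card ((support x \<inter> {1..a}) \<union> (\<lambda>k. k + a) ` (support ((shift ^^ a) x) \<inter> {1..b}))"
    unfolding x(2)[symmetric] by (intro card_mono) auto
  also have "\<dots> \<le> card (support x \<inter> {1..a}) + card ((\<lambda>k. k + a) ` (support ((shift ^^ a) x) \<inter> {1..b}))"
    by (rule card_Un_le)
  also have "\<dots> \<le> max_ones X a + max_ones X b"
    using ones_le_max_ones[OF x(1), of a]
      ones_le_max_ones[OF subshift_shift_power[OF X(1) x(1), of a], of b]
    by (intro add_mono) (auto simp: card_image)
  finally show ?thesis .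
qed

lemma max_ones_le_blocks:
  assumes X: "subshift X" "X \<noteq> {}" and k: "k > 0"
  shows "real (max_ones X n) \<le> (real n / real k + 1) * real (max_ones X k)"
proof -
  have mult: "max_ones X (q * k) \<le> q * max_ones X k" for q
  proof (induction q)
    case (Suc q)
    then show ?case using max_ones_add_le[OF X, of k "q * k"] by simp
  qed (use X in simp)
  have "n \<le> (n div k + 1) * k"
    using dividend_less_div_times[OF k, of n] by simp
  then have "max_ones X n \<le> (n div k + 1) * max_ones X k"
    using max_ones_mono[OF X(2)] mult order_trans by blast
  then have "real (max_ones X n) \<le> (real (n div k) + 1) * real (max_ones X k)"
    by (metis of_nat_1 of_nat_add of_nat_le_iff of_nat_mult)
  also have "\<dots> \<le> (real n / real k + 1) * real (max_ones X k)"
    by (intro mult_right_mono add_mono of_nat_div_le_of_nat) auto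
  finally show ?thesis .
qed

text \<open>
  The entropy is at most \<open>ln 2\<close> times the limit of \<open>max_ones squarefree_flow n / n\<close>; by
  subadditivity that limit is at most each individual quotient. It matters that the bound at \<open>k\<close> has
  no error term: comparing with the number of words of length \<open>k\<close> directly would lose the number of
  choices of residues, which exceeds the gain of \<open>p\<^sup>2\<close> that maximal words provide.
\<close>
lemma h_top_flow_le:
  assumes X: "subshift squarefree_flow" and k: "k > 0"
  shows "real k * h_top squarefree_flow \<le> real (max_ones squarefree_flow k) * ln 2"
proof -
  define c where "c = real (max_ones squarefree_flow k) * ln 2"
  define f where "f n = sqrt (real n) * ln (real n) + (real n / real k + 1) * c" for n
  have "h_top squarefree_flow \<le> c / real k"
  proof (rule h_top_le_word_growth[OF X])
    fix n
    have "real (max_ones squarefree_flow n) * ln 2 \<le> (real n / real k + 1) * c"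
      unfolding c_def mult.assoc[symmetric]
      by (intro mult_right_mono max_ones_le_blocks X flow_nonempty k) auto
    with ln_card_words_flow_le[of n] show "ln (real (card (words squarefree_flow n))) \<le> f n"
      by (simp add: f_def)
  next
    fix L
    show "(\<lambda>n. f (n + L) / real n) \<longlonglongrightarrow> c / real k"
      unfolding f_def using k by (real_asymp simp: field_simps)
  qed
  then show ?thesis using k by (simp add: c_def field_simps)
qed

section \<open>Haar measure and Bernoulli measure of cylinders\<close>

text \<open>
  If \<open>f\<close> is not measurable and the pulled-back set function is not a measure, then \<open>distr M N f\<close> is
  null by convention, which an upper bound tolerates.
\<close>
lemma emeasure_distr_le: "emeasure (distr M N f) A \<le> emeasure M (f -` A \<inter> space M)"
  by (simp add: distr_def emeasure_measure_of_conv)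

lemma space_borel_of [simp]: "space (borel_of T) = topspace T"
  unfolding borel_of_def by (rule space_measure_of) (auto dest: openin_subset)

lemma openin_sets_borel_of: "openin T U \<Longrightarrow> U \<in> sets (borel_of T)"
  unfolding borel_of_def by (subst sets_measure_of) (auto dest: openin_subset)

text \<open>
  The \<open>p\<^sup>2\<close> fibres of the projection to the coordinate \<open>p\<close> partition \<open>G\<close> and are translates of one
  another.
\<close>
lemma haar_measure_residue:
  assumes m: "normalized_haar_measure G G_top m" and p: "prime p" and r: "r \<in> {0..<int (p\<^sup>2)}"
  shows "{g \<in> carrier G. g p = r} \<in> sets m"
    and "measure m {g \<in> carrier G. g p = r} = 1 / (real p)\<^sup>2"
proof -
  interpret prob_space m using m by (simp add: normalized_haar_measure_def)
  define A where "A j = {g \<in> carrier G. g p = j}" for j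
  let ?R = "{0..<int (p\<^sup>2)}"
  have sets_m: "sets m = sets (borel_of G_top)"
    using m by (simp add: normalized_haar_measure_def)
  then have space_m: "space m = carrier G"
    using sets_eq_imp_space_eq[OF sets_m] by (simp add: topspace_G_top)
  have A_sets: "A j \<in> sets m" if "j \<in> ?R" for j
  proof -
    have "continuous_map G_top (discrete_topology (carrier (integer_mod_group (p\<^sup>2)))) (\<lambda>g. g p)"
      unfolding G_top_def using p by (intro continuous_map_product_coordinates) simp
    moreover have "openin (discrete_topology (carrier (integer_mod_group (p\<^sup>2)))) {j}"
      using that by (simp add: carrier_mod_square[OF p])
    ultimately have "openin G_top {g \<in> topspace G_top. g p \<in> {j}}"
      by (rule openin_continuous_map_preimage)
    then have "openin G_top (A j)"
      by (simp add: A_def topspace_G_top)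
    then show ?thesis
      unfolding sets_m by (rule openin_sets_borel_of)
  qed
  have translate: "measure m (A j) = measure m (A 0)" if j: "j \<in> ?R" for j
  proof -
    define t where "t = (\<lambda>q\<in>{q. prime q}. if q = p then j else 0)"
    have t: "t \<in> carrier G"
      using j by (auto simp: t_def carrier_G prime_gt_0_nat)
    have mult: "(t \<otimes>\<^bsub>G\<^esub> h) = (\<lambda>q\<in>{q. prime q}. (t q + h q) mod int (q\<^sup>2))" for h
      by (auto simp: G_def)
    have "A j = t <#\<^bsub>G\<^esub> A 0"
    proof (intro subset_antisym subsetI)
      fix h assume h: "h \<in> A j"
      \<comment> \<open>\<open>t\<close> is the identity outside \<open>p\<close>, so translating back only resets the coordinate \<open>p\<close>.\<close>
      have "h = t \<otimes>\<^bsub>G\<^esub> h(p := 0)"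
      proof
        fix q
        show "h q = (t \<otimes>\<^bsub>G\<^esub> h(p := 0)) q"
          unfolding mult using h p by
            (auto simp: A_def t_def carrier_G PiE_iff extensional_def simp del: of_nat_power)
      qed
      moreover have "h(p := 0) \<in> A 0"
        using h p prime_gt_0_nat[OF p]
        by (auto simp: A_def carrier_G PiE_iff extensional_def simp del: of_nat_power)
      ultimately show "h \<in> t <#\<^bsub>G\<^esub> A 0"
        by (auto simp: l_coset_def)
    next
      fix h assume "h \<in> t <#\<^bsub>G\<^esub> A 0"
      then obtain h0 where h0: "h0 \<in> A 0" "h = t \<otimes>\<^bsub>G\<^esub> h0"
        by (auto simp: l_coset_def)
      have "(t q + h0 q) mod int (q\<^sup>2) \<in> {0..<int (q\<^sup>2)}" if "prime q" for q
        using prime_gt_0_nat[OF that] by simp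
      then have "h \<in> carrier G"
        unfolding h0(2) mult carrier_G restrict_PiE_iff by blast
      moreover have "h p = j"
        unfolding h0(2) mult using h0(1) p j by (simp add: A_def t_def)
      ultimately show "h \<in> A j"
        by (simp add: A_def)
    qed
    moreover have "A 0 \<in> sets m"
      using p by (intro A_sets) (simp add: prime_gt_0_nat)
    then have "emeasure m (t <#\<^bsub>G\<^esub> A 0) = emeasure m (A 0)"
      using m t by (simp add: normalized_haar_measure_def)
    ultimately show ?thesis by (simp add: measure_def)
  qed
  have "carrier G = (\<Union>j\<in>?R. A j)"
    using p by (auto simp: A_def carrier_G simp del: of_nat_power)
  then have "1 = measure m (\<Union>j\<in>?R. A j)"
    using prob_space space_m by simp
  also have "\<dots> = (\<Sum>j\<in>?R. measure m (A j))"
  proof (rule finite_measure_finite_Union)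
    show "A ` ?R \<subseteq> sets m" using A_sets by blast
  qed (auto simp: disjoint_family_on_def A_def)
  also have "\<dots> = (real p)\<^sup>2 * measure m (A 0)"
    using translate by simp
  finally have "measure m (A 0) = 1 / (real p)\<^sup>2"
    using p by (simp add: field_simps)
  with translate[OF r] A_sets[OF r] show "{g \<in> carrier G. g p = r} \<in> sets m"
    "measure m {g \<in> carrier G. g p = r} = 1 / (real p)\<^sup>2"
    by (simp_all add: A_def)
qed

lemma bernoulli_half_initial_ones:
  shows "{y \<in> space bernoulli_half. \<forall>i\<in>{1..M}. y i = 1} \<in> sets bernoulli_half"
    and "emeasure bernoulli_half {y \<in> space bernoulli_half. \<forall>i\<in>{1..M}. y i = 1} = ennreal ((1/2) ^ M)"
    and "prob_space bernoulli_half"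
proof -
  interpret product_prob_space "\<lambda>_. uniform_count_measure {0, 1::nat}" "{1::nat..}"
    by (intro product_prob_spaceI prob_space_uniform_count_measure) auto
  show "prob_space bernoulli_half"
    unfolding bernoulli_half_def by (rule P.prob_space_axioms)
  have eq: "{y \<in> space bernoulli_half. \<forall>i\<in>{1..M}. y i = 1}
      = {y \<in> space (Pi\<^sub>M {1..} (\<lambda>_. uniform_count_measure {0, 1})). \<forall>i\<in>{1..M}. y i \<in> {1}}"
    by (simp add: bernoulli_half_def)
  show em: "emeasure bernoulli_half {y \<in> space bernoulli_half. \<forall>i\<in>{1..M}. y i = 1} = ennreal ((1/2) ^ M)"
    unfolding eq using emeasure_PiM_Collect[of "{1..M}" "\<lambda>_. {1}"]
    by (simp add: bernoulli_half_def sets_uniform_count_measure emeasure_uniform_count_measure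
        divide_ennreal flip: ennreal_power ennreal_numeral)
  show "{y \<in> space bernoulli_half. \<forall>i\<in>{1..M}. y i = 1} \<in> sets bernoulli_half"
    \<comment> \<open>Non-measurable sets get measure 0 by convention.\<close>
    by (rule emeasure_neq_0_sets) (unfold em, simp)
qed

section \<open>Rigidity and measure of maximal words\<close>

lemma rank_image:
  fixes S :: "nat set"
  assumes "finite S" "S \<subseteq> {1..}"
  shows "(\<lambda>k. card (S \<inter> {1..k})) ` S = {1..card S}"
proof -
  let ?r = "\<lambda>k. card (S \<inter> {1..k})"
  have "strict_mono_on S ?r"
  proof (rule strict_mono_onI)
    fix i j assume "i \<in> S" "j \<in> S" "i < j"
    then have "j \<in> (S \<inter> {1..j}) - (S \<inter> {1..i})" using assms(2) by auto
    moreover have "S \<inter> {1..i} \<subseteq> S \<inter> {1..j}" using \<open>i < j\<close> by auto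
    ultimately have "S \<inter> {1..i} \<subset> S \<inter> {1..j}" by blast
    then show "?r i < ?r j" using assms(1) by (intro psubset_card_mono) auto
  qed
  then have "card (?r ` S) = card S"
    by (intro card_image strict_mono_on_imp_inj_on)
  moreover have "?r ` S \<subseteq> {1..card S}"
  proof
    fix i assume "i \<in> ?r ` S"
    then obtain k where k: "k \<in> S" "i = ?r k" by blast
    have "card (S \<inter> {1..k}) \<le> card S" using assms(1) by (intro card_mono) auto
    moreover have "k \<in> S \<inter> {1..k}" using k(1) assms(2) by auto
    then have "card (S \<inter> {1..k}) > 0" using assms(1) by (auto simp: card_gt_0_iff)
    ultimately show "i \<in> {1..card S}" using k(2) by simp
  qed
  ultimately show ?thesis by (intro card_subset_eq) auto
qed

text \<open>
  The index \<open>k - alpha g k\<close> read by the insertion map is the rank of \<open>k\<close> among the unsieved positions.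
\<close>
lemma diff_alpha:
  assumes "k \<le> n" shows "k - alpha g k = card (unsieved g n \<inter> {1..k})"
proof -
  let ?B = "{j. 1 \<le> j \<and> j \<le> k \<and> sieved g j}"
  have "unsieved g n \<inter> {1..k} = {1..k} - ?B"
    using assms by (auto simp: unsieved_def)
  moreover have "card ({1..k} - ?B) = card {1..k} - card ?B"
    by (intro card_Diff_subset finite_subset[of ?B "{1..k}"]) auto
  ultimately show ?thesis by (simp add: alpha_def)
qed

text \<open>
  If the inserted sequence of \<open>(h, y)\<close> starts with the maximal word of \<open>g\<close>, then \<open>h\<close> sieves only
  positions that the truncation of \<open>g\<close> sieves, and maximality forces both to sieve exactly the same
  positions. Hence the residues modulo \<open>p\<^sup>2\<close> agree, because a class other than that of \<open>g\<close> keeps an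
  unsieved member, and every digit of \<open>y\<close> used in the window is read off at a position where the word is 1.
\<close>
lemma maximal_word_determines:
  assumes p: "prime p" and n: "n = 25 * p ^ 4" and g: "g \<in> carrier G"
    and max: "card (unsieved (truncate_residues n g) n) = max_ones squarefree_flow n"
    and h: "h \<in> carrier G"
    and w: "prefix_word n (insertion (h, y)) = indicator_word n (unsieved (truncate_residues n g) n)"
  shows "h p = g p" and "\<forall>i\<in>{1..max_ones squarefree_flow n}. y i = 1"
proof -
  let ?S = "unsieved (truncate_residues n g) n"
  have "insertion (h, y) k = indicator_seq ?S k" if "k \<in> {1..n}" for k
    using w that unfolding prefix_word_indicator_seq[symmetric] prefix_word_eq_iff by blast
  then have one: "insertion (h, y) k = 1" if "k \<in> ?S" for k
    using that by (auto simp: indicator_seq_def unsieved_def)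
  have unsieved: "\<not> sieved h k" if "k \<in> ?S" for k
    using one[OF that] that by (auto simp: insertion_def unsieved_def split: if_splits)
  then have "?S \<subseteq> unsieved h n"
    by (auto simp: unsieved_def)
  then have S_eq: "?S = unsieved h n"
    using card_unsieved_le[OF h, of n] max by (intro card_seteq) auto
  show "h p = g p"
  proof (rule ccontr)
    assume "h p \<noteq> g p"
    then have "\<not> [h p = g p] (mod int (p\<^sup>2))"
      using g h p cong_less_imp_eq_int[of "h p" "int (p\<^sup>2)" "g p"]
      by (auto simp: carrier_G PiE_iff simp del: of_nat_power)
    then obtain k where "k \<in> ?S" "[int k = h p] (mod int (p\<^sup>2))"
      using residue_class_not_sieved[OF p n] by blast
    then show False
      using unsieved p by (auto simp: sieved_def)
  qed
  show "\<forall>i\<in>{1..max_ones squarefree_flow n}. y i = 1"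
  proof
    fix i assume "i \<in> {1..max_ones squarefree_flow n}"
    also have "{1..max_ones squarefree_flow n} = (\<lambda>k. card (?S \<inter> {1..k})) ` ?S"
      unfolding max[symmetric] by (rule rank_image[symmetric]) (auto simp: unsieved_def)
    finally obtain k where k: "k \<in> ?S" "i = card (?S \<inter> {1..k})"
      by blast
    have kn: "1 \<le> k" "k \<le> n" using k(1) by (auto simp: unsieved_def)
    have "i = k - alpha h k"
      using k(2) diff_alpha[OF kn(2), of h] S_eq by simp
    then show "y i = 1"
      using one[OF k(1)] unsieved[OF k(1)] kn by (simp add: insertion_def)
  qed
qed

text \<open>
  The preimage of the cylinder under the insertion map lies in a rectangle, the product of a fibre of
  \<open>G\<close> and a Bernoulli cylinder of ones.
\<close>
lemma eta_maximal_word_le: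
  assumes m: "normalized_haar_measure G G_top m"
    and p: "prime p" and n: "n = 25 * p ^ 4" and g: "g \<in> carrier G"
    and max: "card (unsieved (truncate_residues n g) n) = max_ones squarefree_flow n"
  shows "measure (eta m) (cylinder squarefree_flow (indicator_word n (unsieved (truncate_residues n g) n)))
    \<le> 1 / (real p)\<^sup>2 * (1/2) ^ max_ones squarefree_flow n"
proof -
  interpret m: prob_space m using m by (simp add: normalized_haar_measure_def)
  interpret B: prob_space bernoulli_half by (rule bernoulli_half_initial_ones)
  let ?w = "indicator_word n (unsieved (truncate_residues n g) n)"
  let ?M = "max_ones squarefree_flow n"
  let ?C = "cylinder squarefree_flow ?w"
  let ?A = "{h \<in> carrier G. h p = g p}"
  let ?Y = "{y \<in> space bernoulli_half. \<forall>i\<in>{1..?M}. y i = 1}"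
  have space_m: "space m = carrier G"
    using m sets_eq_imp_space_eq[of m "borel_of G_top"]
    by (simp add: normalized_haar_measure_def topspace_G_top)
  have gp: "g p \<in> {0..<int (p\<^sup>2)}"
    using g p by (auto simp: carrier_G PiE_iff simp del: of_nat_power)
  have sub: "insertion -` ?C \<inter> space (m \<Otimes>\<^sub>M bernoulli_half) \<subseteq> ?A \<times> ?Y"
  proof
    fix hy assume hy: "hy \<in> insertion -` ?C \<inter> space (m \<Otimes>\<^sub>M bernoulli_half)"
    obtain h y where [simp]: "hy = (h, y)" by fastforce
    have h: "h \<in> carrier G" and y: "y \<in> space bernoulli_half"
      using hy by (auto simp: space_pair_measure space_m)
    have "length ?w = n"
      by (simp add: indicator_word_def)
    then have "prefix_word n (insertion (h, y)) = ?w"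
      using hy by (simp add: cylinder_def)
    from maximal_word_determines[OF p n g max h this] show "hy \<in> ?A \<times> ?Y"
      using h y by simp
  qed
  have "emeasure (eta m) ?C \<le> emeasure (m \<Otimes>\<^sub>M bernoulli_half) (insertion -` ?C \<inter> space (m \<Otimes>\<^sub>M bernoulli_half))"
    unfolding eta_def by (rule emeasure_distr_le)
  also have "\<dots> \<le> emeasure (m \<Otimes>\<^sub>M bernoulli_half) (?A \<times> ?Y)"
    using sub haar_measure_residue(1)[OF m p gp] bernoulli_half_initial_ones(1)
    by (intro emeasure_mono pair_measureI)
  also have "\<dots> = emeasure m ?A * emeasure bernoulli_half ?Y"
    using haar_measure_residue(1)[OF m p gp] bernoulli_half_initial_ones(1)
    by (rule B.emeasure_pair_measure_Times)
  also have "\<dots> = ennreal (1 / (real p)\<^sup>2 * (1/2) ^ ?M)"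
    unfolding m.emeasure_eq_measure haar_measure_residue(2)[OF m p gp]
      bernoulli_half_initial_ones(2) by (rule ennreal_mult[symmetric]) auto
  finally show ?thesis
    unfolding measure_def by (rule enn2real_leI[rotated]) auto
qed

section \<open>Failure of the Gibbs property\<close>

theorem proposition4p2:
  fixes m :: "(nat \<Rightarrow> int) measure"
  assumes "normalized_haar_measure G G_top m"
  shows "\<not> gibbs_measure squarefree_flow (eta m)"
proof
  let ?X = squarefree_flow
  assume "gibbs_measure ?X (eta m)"
  then obtain c where X: "subshift ?X" and c: "c > 0"
    and gibbs: "\<And>n w. n \<ge> 1 \<Longrightarrow> w \<in> words ?X n \<Longrightarrow>
      measure (eta m) (cylinder ?X w) \<ge> c * exp (- real n * h_top ?X)"
    unfolding gibbs_measure_def by blast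
  have c_le: "c \<le> 1 / (real p)\<^sup>2" if p: "prime p" for p :: nat
  proof -
    define n where "n = 25 * p ^ 4"
    let ?M = "max_ones ?X n"
    have n_pos: "n > 0" using prime_gt_0_nat[OF p] by (simp add: n_def)
    obtain g where g: "g \<in> carrier G" "card (unsieved (truncate_residues n g) n) = ?M"
      by (rule max_ones_attained_by_sieve)
    let ?w = "indicator_word n (unsieved (truncate_residues n g) n)"
    have "indicator_seq (unsieved (truncate_residues n g) n) \<in> ?X"
      by (intro indicator_seq_unsieved_in_flow truncate_in_carrier g)
    then have "?w \<in> words ?X n"
      unfolding words_def prefix_word_indicator_seq[symmetric] by blast
    have "real n * h_top ?X \<le> real ?M * ln 2"
      using X n_pos by (rule h_top_flow_le)
    then have "exp (- (real ?M * ln 2)) \<le> exp (- real n * h_top ?X)"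
      by simp
    moreover have "exp (- (real ?M * ln 2)) = (1/2) ^ ?M"
      unfolding mult_minus_right[symmetric] exp_of_nat_mult by (simp add: exp_minus)
    ultimately have "c * (1/2) ^ ?M \<le> c * exp (- real n * h_top ?X)"
      using c by simp
    also have "\<dots> \<le> measure (eta m) (cylinder ?X ?w)"
      using n_pos \<open>?w \<in> words ?X n\<close> by (intro gibbs) auto
    also have "\<dots> \<le> 1 / (real p)\<^sup>2 * (1/2) ^ ?M"
      by (rule eta_maximal_word_le[OF assms p n_def g])
    finally have "c * (1/2) ^ ?M \<le> 1 / (real p)\<^sup>2 * (1/2) ^ ?M" .
    then show ?thesis by (rule mult_right_le_imp_le) simp
  qed
  obtain p :: nat where p: "prime p" "nat \<lceil>1 / c\<rceil> < p"
    using bigger_prime by blast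
  then have "1 / c < real p" by linarith
  also have "\<dots> \<le> (real p)\<^sup>2"
    using prime_ge_1_nat[OF p(1)] by (simp add: power2_eq_square)
  finally have "1 / (real p)\<^sup>2 < c"
    using c p(1) prime_gt_0_nat by (simp add: field_simps)
  with c_le[OF p(1)] show False by simp
qed

end
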